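(* There is a deterministic online algorithm for non-linear paging that is $\ell$-competitive, where $\ell=\ell(f)$ is the width of the feasibility function of the instance: on every instance and every request sequence its total eviction cost is at most $\ell(f)\cdot \mathrm{OPT}$, where $\mathrm{OPT}$ is the optimal offline cost. Moreover, every deterministic online algorithm for non-linear paging is at least $\ell$-competitive: for every positive integer $\ell$, no deterministic online algorithm has competitive ratio smaller than $\ell$ on the non-linear paging instances whose feasibility function has width $\ell$.
   Context: Non-linear paging: we are given a finite set $\mathcal{P}$ of pages, each page $p$ having an eviction cost $c(p)\ge 0$; a monotone feasibility function $f:2^{\mathcal{P}}\to\mathbb{N}$ (monotone means $S'\subseteq S$ implies $f(S')\le f(S)$); and a cache threshold $k$, with $f(\{p\})\le k$ for every page $p$. A set $S\subseteq\mathcal{P}$ is feasible if $f(S)\le k$ and infeasible otherwise. The cache is initially empty. Requests $p_t\in\mathcal{P}$ arrive online at time steps $t=1,2,\dots$. At time $t$, if $p_t$ is not in the cache it is fetched into the cache, and the algorithm may evict pages (other than $p_t$) so that the set $S_t$ of pages in the cache after serving the request satisfies $f(S_t)\le k$. The cost is the sum of $c(p)$ over all eviction events. An online algorithm is $\rho$-competitive if on every request sequence its cost (expected cost, if randomized) is at most $\rho$ times the optimal offline cost $\mathrm{OPT}$. A set $S$ is minimally infeasible if $f(S)>k$ and $f(S')\le k$ for every proper subset $S'\subsetneq S$. The width of $f$ is $\ell(f)=\max\{|S|-1 : S \text{ minimally infeasible}\}$. *)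

theory Defs
  imports Complex_Main
begin

record 'p paging_instance =
  pages :: "'p set"
  evict_cost :: "'p \<Rightarrow> real"
  feas_fun :: "'p set \<Rightarrow> nat"
  threshold :: nat

definition paging_instance :: "'p paging_instance \<Rightarrow> bool" where
  "paging_instance I \<longleftrightarrow>
     finite (pages I) \<and>
     (\<forall>p\<in>pages I. 0 \<le> evict_cost I p) \<and>
     mono_on (Pow (pages I)) (feas_fun I) \<and>
     (\<forall>p\<in>pages I. feas_fun I {p} \<le> threshold I)"

definition feasible :: "'p paging_instance \<Rightarrow> 'p set \<Rightarrow> bool" where
  "feasible I S \<longleftrightarrow> feas_fun I S \<le> threshold I"

definition minimally_infeasible :: "'p paging_instance \<Rightarrow> 'p set \<Rightarrow> bool" where
  "minimally_infeasible I S \<longleftrightarrow>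
     S \<subseteq> pages I \<and> \<not> feasible I S \<and> (\<forall>S'. S' \<subset> S \<longrightarrow> feasible I S')"

text \<open>If every set of pages is feasible, the maximum ranges over the empty set; the width
  is then taken to be 0.\<close>

definition width :: "'p paging_instance \<Rightarrow> nat" where
  "width I =
     (if \<exists>S. minimally_infeasible I S
      then Max {card S - 1 | S. minimally_infeasible I S} else 0)"

text \<open>\<open>schedule I S ps Ts\<close>: starting with cache contents \<open>S\<close>, the request sequence \<open>ps\<close> can be
  served so that \<open>Ts\<close> lists the cache contents after each request. Only the requested page is
  ever fetched, and it is not evicted while it is being served.\<close>

fun schedule :: "'p paging_instance \<Rightarrow> 'p set \<Rightarrow> 'p list \<Rightarrow> 'p set list \<Rightarrow> bool" where
  "schedule I S [] [] \<longleftrightarrow> True"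
| "schedule I S (p # ps) (T # Ts) \<longleftrightarrow>
     p \<in> T \<and> T \<subseteq> insert p S \<and> feasible I T \<and> schedule I T ps Ts"
| "schedule I S _ _ \<longleftrightarrow> False"

fun schedule_cost :: "'p paging_instance \<Rightarrow> 'p set \<Rightarrow> 'p set list \<Rightarrow> real" where
  "schedule_cost I S [] = 0"
| "schedule_cost I S (T # Ts) = (\<Sum>p\<in>S - T. evict_cost I p) + schedule_cost I T Ts"

text \<open>The infimum is a minimum, see \<open>opt_attained\<close> below.\<close>

definition opt :: "'p paging_instance \<Rightarrow> 'p list \<Rightarrow> real" where
  "opt I ps = Inf {schedule_cost I {} Ts | Ts. schedule I {} ps Ts}"

text \<open>A deterministic online algorithm knows the instance; after each request it determines the
  cache contents from the requests seen so far (the last one being the current request). The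
  internal state of an algorithm is a function of these data.\<close>

type_synonym 'p online_alg = "'p paging_instance \<Rightarrow> 'p list \<Rightarrow> 'p set"

definition alg_run :: "'p online_alg \<Rightarrow> 'p paging_instance \<Rightarrow> 'p list \<Rightarrow> 'p set list" where
  "alg_run A I ps = map (\<lambda>t. A I (take t ps)) [1..<Suc (length ps)]"

definition online_algorithm :: "'p online_alg \<Rightarrow> bool" where
  "online_algorithm A \<longleftrightarrow>
     (\<forall>I. paging_instance I \<longrightarrow>
        (\<forall>ps. set ps \<subseteq> pages I \<longrightarrow> schedule I {} ps (alg_run A I ps)))"

definition alg_cost :: "'p online_alg \<Rightarrow> 'p paging_instance \<Rightarrow> 'p list \<Rightarrow> real" where
  "alg_cost A I ps = schedule_cost I {} (alg_run A I ps)"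

definition competitive_on :: "'p online_alg \<Rightarrow> 'p paging_instance \<Rightarrow> real \<Rightarrow> bool" where
  "competitive_on A I \<rho> \<longleftrightarrow>
     (\<forall>ps. set ps \<subseteq> pages I \<longrightarrow> alg_cost A I ps \<le> \<rho> * opt I ps)"

lemma schedule_ex:
  assumes "paging_instance I" "set ps \<subseteq> pages I"
  shows "schedule I S ps (map (\<lambda>p. {p}) ps)"
proof -
  have feas: "\<And>p. p \<in> pages I \<Longrightarrow> feasible I {p}"
    using assms(1) by (simp add: paging_instance_def feasible_def)
  show ?thesis
    using assms(2) by (induction ps arbitrary: S) (simp_all add: feas)
qed

lemma schedule_bounded:
  "schedule I S ps Ts \<Longrightarrow> set Ts \<subseteq> Pow (S \<union> set ps) \<and> length Ts = length ps"
proof (induction I S ps Ts rule: schedule.induct)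
  case (2 I S p ps T Ts)
  then have Ts: "set Ts \<subseteq> Pow (T \<union> set ps)" and T: "T \<subseteq> insert p S"
    and len: "length Ts = length ps"
    by simp_all
  have "Pow (T \<union> set ps) \<subseteq> Pow (S \<union> set (p # ps))"
    using T by (intro Pow_mono) auto
  moreover have "T \<in> Pow (S \<union> set (p # ps))"
    using T by auto
  ultimately show ?case
    using Ts len by simp
qed simp_all

lemma opt_attained:
  assumes "paging_instance I" "set ps \<subseteq> pages I"
  shows "\<exists>Ts. schedule I {} ps Ts \<and> schedule_cost I {} Ts = opt I ps"
    and "schedule I {} ps Ts' \<Longrightarrow> opt I ps \<le> schedule_cost I {} Ts'"
proof -
  define C where "C = schedule_cost I {} ` {Ts. schedule I {} ps Ts}"
  have "{Ts. schedule I {} ps Ts} \<subseteq> {Ts. set Ts \<subseteq> Pow (set ps) \<and> length Ts = length ps}"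
    using schedule_bounded[of I "{}" ps] by (intro Collect_mono impI) simp
  then have fin: "finite C"
    unfolding C_def
    by (intro finite_imageI) (rule finite_subset, assumption, intro finite_lists_length_eq, simp)
  have ne: "C \<noteq> {}"
    using schedule_ex[OF assms] unfolding C_def by (metis empty_iff image_eqI mem_Collect_eq)
  have eq: "opt I ps = Min C"
    unfolding opt_def setcompr_eq_image C_def[symmetric] by (rule cInf_eq_Min[OF fin ne])
  show "\<exists>Ts. schedule I {} ps Ts \<and> schedule_cost I {} Ts = opt I ps"
    using Min_in[OF fin ne] unfolding eq[symmetric] by (simp add: C_def image_iff) metis
  show "opt I ps \<le> schedule_cost I {} Ts'" if "schedule I {} ps Ts'"
    unfolding eq by (rule Min_le[OF fin]) (simp add: C_def that)
qed

end

theory Submission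
  imports Defs
begin

text \<open>Upper bound: every cached page \<open>q\<close> carries a credit \<open>w q\<close>, which is reset to its eviction
  cost \<open>c q\<close> whenever \<open>q\<close> is requested. While the cache is infeasible, choose a minimally infeasible
  subset \<open>M\<close> of it; \<open>M\<close> contains the requested page \<open>p\<close>. Lower the credits of the at most \<open>\<ell>\<close> pages
  in \<open>M - {p}\<close> at equal speed until one of them has no credit left, and evict that page. Every
  offline cache \<open>T\<close> that is feasible and contains \<open>p\<close> misses a page of \<open>M - {p}\<close>, so the potential
  \<open>\<Sum>q\<in>S. (c q - w q)\<close> plus \<open>\<ell>\<close> times \<open>\<Sum>q\<in>S - T. w q\<close>, increased by the cost paid so far,
  does not grow, whereas an offline eviction of \<open>q\<close> increases it by at most \<open>\<ell> * c q\<close>.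

  Lower bound: take \<open>\<ell> + 1\<close> pages of unit cost of which any \<open>\<ell>\<close> fit into the cache, and always
  request a page missing from the online cache. Every request is then a fault, while evicting a
  page that is not among the next \<open>\<ell>\<close> requests gives an offline schedule with only one eviction per
  \<open>\<ell>\<close> requests.\<close>

section \<open>Schedules extended at the end\<close>

lemma schedule_length: "schedule I S ps Ts \<Longrightarrow> length Ts = length ps"
  using schedule_bounded by blast

text \<open>\<open>schedule\<close> recurses from the front, while online decisions and the
  potential argument append requests at the end. Here \<open>last (S # Ts)\<close> is the current
  cache, also for empty \<open>Ts\<close>.\<close>

lemma schedule_snoc:
  assumes "length Ts = length ps"
  shows "schedule I S (ps @ [p]) (Ts @ [T]) \<longleftrightarrow>
    schedule I S ps Ts \<and> p \<in> T \<and> T \<subseteq> insert p (last (S # Ts)) \<and> feasible I T"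
  using assms
proof (induction ps Ts arbitrary: S rule: list_induct2')
  case (4 x xs y ys)
  then show ?case by auto
qed auto

lemma schedule_cost_snoc:
  "schedule_cost I S (Ts @ [T]) =
     schedule_cost I S Ts + (\<Sum>p\<in>last (S # Ts) - T. evict_cost I p)"
  by (induction Ts arbitrary: S) auto

lemma schedule_snocE:
  assumes "schedule I S (ps @ [p]) Ts"
  obtains Us U where "Ts = Us @ [U]" "schedule I S ps Us" "p \<in> U"
    "U \<subseteq> insert p (last (S # Us))" "feasible I U"
proof -
  have len: "length Ts = Suc (length ps)"
    using schedule_length[OF assms] by simp
  then obtain Us U where Ts: "Ts = Us @ [U]"
    by (metis length_Suc_conv_rev)
  with len have "length Us = length ps" by simp
  from schedule_snoc[OF this] assms have "schedule I S ps Us" "p \<in> U"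
    "U \<subseteq> insert p (last (S # Us))" "feasible I U"
    unfolding Ts by blast+
  with Ts show thesis by (rule that)
qed

lemma schedule_last_subset:
  assumes "schedule I S ps Ts"
  shows "last (S # Ts) \<subseteq> S \<union> set ps"
  using schedule_bounded[OF assms] by (cases Ts rule: rev_cases) auto

lemma schedule_cost_nonneg:
  assumes "paging_instance I" "S \<subseteq> pages I" "set ps \<subseteq> pages I" "schedule I S ps Ts"
  shows "0 \<le> schedule_cost I S Ts"
  using assms(2-)
proof (induction ps Ts arbitrary: S rule: list_induct2')
  case (4 p ps T Ts)
  then have "T \<subseteq> pages I" by auto
  with 4 have "0 \<le> schedule_cost I T Ts" by simp
  moreover have "0 \<le> (\<Sum>p\<in>S - T. evict_cost I p)"
    using assms(1) 4(2) by (intro sum_nonneg) (auto simp: paging_instance_def)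
  ultimately show ?case by simp
qed auto

lemma alg_run_Nil [simp]: "alg_run A I [] = []"
  by (simp add: alg_run_def)

lemma alg_run_snoc: "alg_run A I (ps @ [p]) = alg_run A I ps @ [A I (ps @ [p])]"
  by (auto simp: alg_run_def intro!: map_cong)

lemma length_alg_run [simp]: "length (alg_run A I ps) = length ps"
  unfolding alg_run_def by (simp del: upt_Suc)

text \<open>The value of \<open>A\<close> on the empty request list is unconstrained, so that case
  must be separated: the cache then is the initial \<open>{}\<close>.\<close>

lemma last_alg_run: "last ({} # alg_run A I ps) = (if ps = [] then {} else A I ps)"
  by (cases ps rule: rev_cases) (auto simp: alg_run_snoc)

section \<open>Minimally infeasible sets\<close>

lemma feasible_subset:
  assumes "paging_instance I" "feasible I T" "T \<subseteq> pages I" "S \<subseteq> T"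
  shows "feasible I S"
proof -
  have "feas_fun I S \<le> feas_fun I T"
    using assms by (auto simp: paging_instance_def intro: mono_onD)
  with assms(2) show ?thesis by (simp add: feasible_def)
qed

lemma minimally_infeasible_subset_exists:
  assumes "finite S" "S \<subseteq> pages I" "\<not> feasible I S"
  obtains M where "M \<subseteq> S" "minimally_infeasible I M"
proof -
  have "\<exists>M\<subseteq>S. minimally_infeasible I M"
    using assms
  proof (induction S rule: finite_psubset_induct)
    case (psubset S)
    show ?case
    proof (cases "\<forall>S'. S' \<subset> S \<longrightarrow> feasible I S'")
      case True
      with psubset.prems show ?thesis by (auto simp: minimally_infeasible_def)
    next
      case False
      then obtain S' where "S' \<subset> S" "\<not> feasible I S'" by blast
      with psubset.IH[of S'] psubset.prems show ?thesis by (meson order.trans psubset_imp_subset)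
    qed
  qed
  with that show thesis by blast
qed

lemma card_minimally_infeasible_le_width:
  assumes "paging_instance I" "minimally_infeasible I M"
  shows "card M - 1 \<le> width I"
proof -
  have "{card S - 1 | S. minimally_infeasible I S} \<subseteq> (\<lambda>S. card S - 1) ` Pow (pages I)"
    by (auto simp: minimally_infeasible_def)
  then have "finite {card S - 1 | S. minimally_infeasible I S}"
    using assms(1) by (meson finite_Pow_iff finite_imageI finite_subset paging_instance_def)
  then show ?thesis
    using assms(2) unfolding width_def by (auto intro!: Max_ge)
qed

section \<open>The credit algorithm\<close>

definition valid_credit :: "'p paging_instance \<Rightarrow> 'p set \<Rightarrow> ('p \<Rightarrow> real) \<Rightarrow> bool" where
  "valid_credit I S w \<longleftrightarrow> (\<forall>q\<in>S. 0 \<le> w q \<and> w q \<le> evict_cost I q)"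

text \<open>\<open>T\<close> is the offline cache. The first sum is the credit already spent on the
  cached pages, the second the credit left on pages that offline lacks.\<close>

definition credit_potential ::
  "'p paging_instance \<Rightarrow> 'p set \<Rightarrow> ('p \<Rightarrow> real) \<Rightarrow> 'p set \<Rightarrow> real" where
  "credit_potential I S w T =
     (\<Sum>q\<in>S. evict_cost I q - w q) + real (width I) * (\<Sum>q\<in>S - T. w q)"

text \<open>Specification of all evictions made for one request to \<open>p\<close>. The amortized
  inequality ranges over every possible offline cache \<open>T\<close>, since an online choice
  cannot depend on the actual one.\<close>

definition eviction_outcome ::
  "'p paging_instance \<Rightarrow> 'p \<Rightarrow> 'p set \<times> ('p \<Rightarrow> real) \<Rightarrow> 'p set \<times> ('p \<Rightarrow> real) \<Rightarrow> bool" where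
  "eviction_outcome I p = (\<lambda>(S, w) (S', w').
     p \<in> S' \<and> S' \<subseteq> S \<and> feasible I S' \<and> valid_credit I S' w' \<and>
     (\<forall>T. p \<in> T \<and> T \<subseteq> pages I \<and> feasible I T \<longrightarrow>
        (\<Sum>q\<in>S - S'. evict_cost I q) + credit_potential I S' w' T \<le> credit_potential I S w T))"

text \<open>Lowering the credits on \<open>N\<close> by \<delta> raises the spent credit by
  \<open>card N * \<delta>\<close>, at most \<open>width I * \<delta>\<close>; the second part of
  the potential falls by at least that much because \<open>T\<close> misses a page of
  \<open>N\<close>. The spent credit of the evicted page then pays for its eviction.\<close>

lemma single_eviction:
  assumes I: "paging_instance I" and S: "S \<subseteq> pages I" "p \<in> S" "feasible I (S - {p})"
    and infeas: "\<not> feasible I S" and w: "valid_credit I S w"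
  obtains q w' where "q \<in> S" "q \<noteq> p" "valid_credit I (S - {q}) w'"
    "\<And>T. p \<in> T \<Longrightarrow> T \<subseteq> pages I \<Longrightarrow> feasible I T \<Longrightarrow>
       evict_cost I q + credit_potential I (S - {q}) w' T \<le> credit_potential I S w T"
proof -
  have finS: "finite S"
    using I S(1) by (auto simp: paging_instance_def intro: finite_subset)
  obtain M where M: "M \<subseteq> S" "minimally_infeasible I M"
    using minimally_infeasible_subset_exists[OF finS S(1) infeas] .
  define N where "N = M - {p}"
  have finM: "finite M" "finite N" and NS: "N \<subseteq> S"
    using M(1) finS by (auto simp: N_def intro: finite_subset)
  have Minf: "\<not> feasible I M"
    using M(2) by (simp add: minimally_infeasible_def)
  have pM: "p \<in> M"
  proof (rule ccontr)
    assume "p \<notin> M"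
    then have "M \<subseteq> S - {p}" using M(1) by blast
    with feasible_subset[OF I S(3)] S(1) Minf show False by blast
  qed
  \<comment> \<open>Single pages fit, so \<open>M\<close> contains a page other than
    \<open>p\<close> that may be evicted.\<close>
  have "feasible I {p}"
    using I S by (auto simp: paging_instance_def feasible_def)
  with Minf have "M \<noteq> {p}" by blast
  with pM have Nne: "N \<noteq> {}"
    unfolding N_def by blast
  have cardN: "real (card N) \<le> real (width I)"
    using card_minimally_infeasible_le_width[OF I M(2)] pM finM by (simp add: N_def)
  define \<delta> where "\<delta> = Min (w ` N)"
  have \<delta>_le: "\<delta> \<le> w r" if "r \<in> N" for r
    using that finM by (simp add: \<delta>_def)
  obtain q where q: "q \<in> N" "w q = \<delta>"
    using Min_in[of "w ` N"] finM(2) Nne unfolding \<delta>_def by fastforce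
  have \<delta>0: "0 \<le> \<delta>"
    using q NS w by (auto simp: valid_credit_def)
  define w' where "w' = (\<lambda>r. w r - (if r \<in> N then \<delta> else 0))"
  have sum_w': "(\<Sum>r\<in>X. w' r) = (\<Sum>r\<in>X. w r) - real (card (X \<inter> N)) * \<delta>" if "X \<subseteq> S" for X
  proof -
    have "finite X" using that finS by (rule finite_subset)
    then show ?thesis
      by (simp add: w'_def sum_subtractf sum.If_cases)
  qed
  have qS: "q \<in> S" "q \<noteq> p" "w' q = 0"
    using q NS by (auto simp: N_def w'_def)
  have "evict_cost I q + credit_potential I (S - {q}) w' T \<le> credit_potential I S w T"
    if T: "p \<in> T" "T \<subseteq> pages I" "feasible I T" for T
  proof -
    \<comment> \<open>A feasible \<open>T\<close> cannot contain \<open>M\<close>, and it contains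
      \<open>p\<close>; so the missing page lies in \<open>N\<close>, and its lowered credit is
      counted in \<open>S - T\<close>.\<close>
    have "\<not> M \<subseteq> T"
      using feasible_subset[OF I T(3) T(2)] Minf by blast
    then have "(S - T) \<inter> N \<noteq> {}"
      using T(1) M(1) by (auto simp: N_def)
    then have "1 \<le> real (card ((S - T) \<inter> N))"
      using finM by (simp add: Suc_le_eq card_gt_0_iff)
    then have less: "(\<Sum>r\<in>S - T. w' r) \<le> (\<Sum>r\<in>S - T. w r) - \<delta>"
      using sum_w'[of "S - T"] \<delta>0 by (simp add: mult_le_cancel_right1)
    \<comment> \<open>As \<open>w' q = 0\<close>, the term of \<open>q\<close> in the first sum is
      its full eviction cost.\<close>
    have "(\<Sum>r\<in>S - {q}. evict_cost I r - w' r) + evict_cost I q = (\<Sum>r\<in>S. evict_cost I r - w' r)"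
      using qS finS by (simp add: sum.remove[of S q])
    also have "\<dots> = (\<Sum>r\<in>S. evict_cost I r - w r) + real (card N) * \<delta>"
      using sum_w'[of S] NS by (simp add: sum_subtractf Int_absorb1)
    also have "\<dots> \<le> (\<Sum>r\<in>S. evict_cost I r - w r) + real (width I) * \<delta>"
      using cardN \<delta>0 by (simp add: mult_right_mono)
    finally have 1: "(\<Sum>r\<in>S - {q}. evict_cost I r - w' r) + evict_cost I q
      \<le> (\<Sum>r\<in>S. evict_cost I r - w r) + real (width I) * \<delta>" .
    have "(\<Sum>r\<in>S - {q} - T. w' r) = (\<Sum>r\<in>S - T. w' r)"
      using finS qS by (intro sum.mono_neutral_left) auto
    then have "real (width I) * (\<Sum>r\<in>S - {q} - T. w' r)
      \<le> real (width I) * ((\<Sum>r\<in>S - T. w r) - \<delta>)"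
      using less by (simp add: mult_left_mono)
    with 1 show ?thesis
      by (simp add: credit_potential_def algebra_simps)
  qed
  moreover have "valid_credit I (S - {q}) w'"
    using w \<delta>_le \<delta>0 by (fastforce simp: valid_credit_def w'_def)
  ultimately show thesis
    using that qS by blast
qed

lemma eviction_outcome_exists:
  assumes I: "paging_instance I" and "S \<subseteq> pages I" "p \<in> S" "feasible I (S - {p})"
    "valid_credit I S w"
  shows "\<exists>s. eviction_outcome I p (S, w) s"
  using assms(2-)
proof (induction "card S" arbitrary: S w rule: less_induct)
  case less
  show ?case
  proof (cases "feasible I S")
    case True
    with less.prems have "eviction_outcome I p (S, w) (S, w)"
      by (simp add: eviction_outcome_def)
    then show ?thesis by blast
  next
    case False
    obtain q w1 where q: "q \<in> S" "q \<noteq> p" "valid_credit I (S - {q}) w1"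
      and pot: "\<And>T. p \<in> T \<Longrightarrow> T \<subseteq> pages I \<Longrightarrow> feasible I T \<Longrightarrow>
        evict_cost I q + credit_potential I (S - {q}) w1 T \<le> credit_potential I S w T"
      by (rule single_eviction[OF I less.prems(1-3) False less.prems(4)]) blast
    have finS: "finite S"
      using I less.prems(1) by (auto simp: paging_instance_def intro: finite_subset)
    \<comment> \<open>The premise that the cache without \<open>p\<close> is feasible survives
      evictions, so the induction continues and the potential drops add up.\<close>
    have "feasible I (S - {q} - {p})"
      by (rule feasible_subset[OF I less.prems(3)]) (use less.prems(1) in auto)
    moreover have "card (S - {q}) < card S"
      using finS q(1) by (rule card_Diff1_less)
    ultimately obtain S' w' where out: "eviction_outcome I p (S - {q}, w1) (S', w')"
      using less.hyps[of "S - {q}" w1] less.prems q by fastforce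
    have cost: "(\<Sum>r\<in>S - S'. evict_cost I r)
        = evict_cost I q + (\<Sum>r\<in>S - {q} - S'. evict_cost I r)"
    proof -
      have "S - S' = insert q (S - {q} - S')"
        using out q(1) by (auto simp: eviction_outcome_def)
      then show ?thesis
        using finS by (metis Diff_iff finite_Diff insertI1 sum.insert)
    qed
    have "eviction_outcome I p (S, w) (S', w')"
      unfolding eviction_outcome_def prod.case
    proof (intro conjI allI impI)
      fix T assume T: "p \<in> T \<and> T \<subseteq> pages I \<and> feasible I T"
      then have "(\<Sum>r\<in>S - {q} - S'. evict_cost I r) + credit_potential I S' w' T
          \<le> credit_potential I (S - {q}) w1 T"
        using out unfolding eviction_outcome_def by blast
      with pot[of T] T show "(\<Sum>r\<in>S - S'. evict_cost I r) + credit_potential I S' w' T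
          \<le> credit_potential I S w T"
        unfolding cost by linarith
    qed (use out in \<open>auto simp: eviction_outcome_def\<close>)
    then show ?thesis by blast
  qed
qed

section \<open>The online algorithm and its invariant\<close>

definition credit_step ::
  "'p paging_instance \<Rightarrow> 'p set \<times> ('p \<Rightarrow> real) \<Rightarrow> 'p \<Rightarrow> 'p set \<times> ('p \<Rightarrow> real)" where
  "credit_step I s p =
     (SOME s'. eviction_outcome I p (insert p (fst s), (snd s)(p := evict_cost I p)) s')"

text \<open>The \<open>SOME\<close> in \<open>credit_step\<close> is a fixed choice depending only
  on the instance, state and request, so the fold is deterministic and online. The initial credit 0
  is a dummy: a page enters the cache only when requested, and its credit is then
  overwritten.\<close>

definition credit_state :: "'p paging_instance \<Rightarrow> 'p list \<Rightarrow> 'p set \<times> ('p \<Rightarrow> real)" where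
  "credit_state I ps = foldl (credit_step I) ({}, \<lambda>_. 0) ps"

definition credit_alg :: "'p online_alg" where
  "credit_alg I ps = fst (credit_state I ps)"

lemma credit_alg_Nil [simp]: "credit_alg I [] = {}"
  by (simp add: credit_alg_def credit_state_def)

lemma last_credit_run: "last ({} # alg_run credit_alg I ps) = credit_alg I ps"
  unfolding last_alg_run by simp

lemma credit_step_outcome:
  assumes I: "paging_instance I" and p: "p \<in> pages I" and S: "S \<subseteq> pages I"
    "S = {} \<or> feasible I S" and w: "valid_credit I S w"
  shows "eviction_outcome I p (insert p S, w(p := evict_cost I p)) (credit_step I (S, w) p)"
proof -
  have "feasible I {p}"
    using I p by (simp add: paging_instance_def feasible_def)
  \<comment> \<open>An instance without pages may have an infeasible empty set, hence the
    alternative \<open>S = {}\<close> in the assumption; the request \<open>p\<close> excludes that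
    situation here.\<close>
  then have "feasible I {}"
    by (rule feasible_subset[OF I]) (use p in auto)
  then have "feasible I S"
    using S(2) by blast
  then have "feasible I (insert p S - {p})"
    by (rule feasible_subset[OF I]) (use S(1) in auto)
  moreover have "valid_credit I (insert p S) (w(p := evict_cost I p))"
    using w I p by (auto simp: valid_credit_def paging_instance_def)
  ultimately have "\<exists>s. eviction_outcome I p (insert p S, w(p := evict_cost I p)) s"
    by (intro eviction_outcome_exists[OF I]) (use S(1) p in auto)
  then show ?thesis
    unfolding credit_step_def fst_conv snd_conv by (rule someI_ex)
qed

lemma credit_state_invariant:
  assumes I: "paging_instance I" and "set ps \<subseteq> pages I" "credit_state I ps = (S, w)"
  shows "schedule I {} ps (alg_run credit_alg I ps) \<and> S \<subseteq> pages I \<and> (S = {} \<or> feasible I S) \<and>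
    valid_credit I S w"
  using assms(2-)
proof (induction ps arbitrary: S w rule: rev_induct)
  case Nil
  then show ?case by (auto simp: credit_state_def valid_credit_def)
next
  case (snoc p ps)
  obtain S0 w0 where s0: "credit_state I ps = (S0, w0)" by fastforce
  have IH: "schedule I {} ps (alg_run credit_alg I ps)" "S0 \<subseteq> pages I" "S0 = {} \<or> feasible I S0"
    "valid_credit I S0 w0"
    using snoc.IH[OF _ s0] snoc.prems(1) by auto
  have p: "p \<in> pages I" using snoc.prems(1) by simp
  have step: "credit_step I (S0, w0) p = (S, w)"
    using snoc.prems(2) s0 by (simp add: credit_state_def)
  then have out: "eviction_outcome I p (insert p S0, w0(p := evict_cost I p)) (S, w)"
    using credit_step_outcome[OF I p IH(2-4)] by simp
  have "credit_alg I (ps @ [p]) = S" "last ({} # alg_run credit_alg I ps) = S0"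
    using snoc.prems(2) s0 unfolding last_credit_run by (simp_all add: credit_alg_def)
  with out IH p show ?case
    by (auto simp: alg_run_snoc schedule_snoc eviction_outcome_def simp del: last.simps)
qed

section \<open>Amortized analysis\<close>

text \<open>Each request is split in two: first both sides fetch \<open>p\<close> and offline moves
  from \<open>T\<close> to \<open>U\<close>, raising the potential by at most \<open>width I\<close>
  times the offline cost; then the online evictions are paid by the potential relative to
  \<open>U\<close>.\<close>

lemma credit_potential_bound:
  assumes I: "paging_instance I" and "set ps \<subseteq> pages I" "credit_state I ps = (S, w)"
    "schedule I {} ps Ts"
  shows "alg_cost credit_alg I ps + credit_potential I S w (last ({} # Ts))
    \<le> real (width I) * schedule_cost I {} Ts"
  using assms(2-)
proof (induction ps arbitrary: S w Ts rule: rev_induct)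
  case Nil
  then have "Ts = []" using schedule_length by fastforce
  with Nil show ?case by (auto simp: credit_state_def alg_cost_def credit_potential_def)
next
  case (snoc p ps)
  obtain Us U where U: "Ts = Us @ [U]" "schedule I {} ps Us" "p \<in> U"
    "U \<subseteq> insert p (last ({} # Us))" "feasible I U"
    using schedule_snocE[OF snoc.prems(3)] .
  define T where "T = last ({} # Us)"
  obtain S0 w0 where s0: "credit_state I ps = (S0, w0)" by fastforce
  have ps: "set ps \<subseteq> pages I" and p: "p \<in> pages I" using snoc.prems(1) by auto
  note inv = credit_state_invariant[OF I ps s0]
  have IH: "alg_cost credit_alg I ps + credit_potential I S0 w0 T
    \<le> real (width I) * schedule_cost I {} Us"
    unfolding T_def by (rule snoc.IH[OF ps s0 U(2)])
  have "T \<subseteq> pages I"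
    using schedule_last_subset[OF U(2)] ps by (auto simp: T_def simp del: last.simps)
  then have UI: "U \<subseteq> pages I"
    using U(4) p by (auto simp: T_def simp del: last.simps)
  have fin: "finite S0" "finite T"
    using I inv \<open>T \<subseteq> pages I\<close> by (auto simp: paging_instance_def intro: finite_subset)
  have step: "credit_step I (S0, w0) p = (S, w)"
    using snoc.prems(2) s0 by (simp add: credit_state_def)
  define w1 where "w1 = w0(p := evict_cost I p)"
  have out: "eviction_outcome I p (insert p S0, w1) (S, w)"
    using credit_step_outcome[OF I p, of S0 w0] inv step by (simp add: w1_def)
  have S: "credit_alg I (ps @ [p]) = S" "last ({} # alg_run credit_alg I ps) = S0"
    using snoc.prems(2) s0 unfolding last_credit_run by (simp_all add: credit_alg_def)
  \<comment> \<open>The requested page stays in \<open>S\<close>, so fetching it first does not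
    alter the eviction cost.\<close>
  have "S0 - S = insert p S0 - S"
    using out by (auto simp: eviction_outcome_def)
  then have cost: "alg_cost credit_alg I (ps @ [p])
      = alg_cost credit_alg I ps + (\<Sum>q\<in>insert p S0 - S. evict_cost I q)"
    using S unfolding alg_cost_def alg_run_snoc schedule_cost_snoc by simp
  have evict: "(\<Sum>q\<in>insert p S0 - S. evict_cost I q) + credit_potential I S w U
      \<le> credit_potential I (insert p S0) w1 U"
    using out U(3,5) UI unfolding eviction_outcome_def by blast
  \<comment> \<open>Resetting the credit of \<open>p\<close> makes its term vanish, so the spent
    credit cannot grow.\<close>
  have "(\<Sum>q\<in>insert p S0. evict_cost I q - w1 q) \<le> (\<Sum>q\<in>S0. evict_cost I q - w0 q)"
  proof -
    have "(\<Sum>q\<in>insert p S0. evict_cost I q - w1 q) = (\<Sum>q\<in>S0 - {p}. evict_cost I q - w1 q)"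
      using fin by (intro sum.mono_neutral_right) (auto simp: w1_def)
    also have "\<dots> = (\<Sum>q\<in>S0 - {p}. evict_cost I q - w0 q)"
      by (intro sum.cong) (auto simp: w1_def)
    also have "\<dots> \<le> (\<Sum>q\<in>S0. evict_cost I q - w0 q)"
      using fin inv by (intro sum_mono2) (auto simp: valid_credit_def)
    finally show ?thesis .
  qed
  \<comment> \<open>The page \<open>p\<close> is in \<open>U\<close>. Any other online page missing
    from \<open>U\<close> was already missing from \<open>T\<close> or has just been evicted
    offline; in the latter case its credit is at most its cost.\<close>
  moreover have "(\<Sum>q\<in>insert p S0 - U. w1 q)
      \<le> (\<Sum>q\<in>S0 - T. w0 q) + (\<Sum>q\<in>T - U. evict_cost I q)"
  proof -
    have "(\<Sum>q\<in>insert p S0 - U. w1 q) = (\<Sum>q\<in>S0 - U. w0 q)"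
      using U(3) by (intro sum.cong) (auto simp: w1_def)
    also have "\<dots> \<le> (\<Sum>q\<in>(S0 - T) \<union> (S0 \<inter> T - U). w0 q)"
      using fin inv by (intro sum_mono2) (auto simp: valid_credit_def)
    also have "\<dots> = (\<Sum>q\<in>S0 - T. w0 q) + (\<Sum>q\<in>S0 \<inter> T - U. w0 q)"
      using fin by (intro sum.union_disjoint) auto
    also have "(\<Sum>q\<in>S0 \<inter> T - U. w0 q) \<le> (\<Sum>q\<in>S0 \<inter> T - U. evict_cost I q)"
      using inv by (intro sum_mono) (auto simp: valid_credit_def)
    also have "\<dots> \<le> (\<Sum>q\<in>T - U. evict_cost I q)"
      using fin I \<open>T \<subseteq> pages I\<close> by (intro sum_mono2) (auto simp: paging_instance_def)
    finally show ?thesis by simp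
  qed
  then have "real (width I) * (\<Sum>q\<in>insert p S0 - U. w1 q)
      \<le> real (width I) * ((\<Sum>q\<in>S0 - T. w0 q) + (\<Sum>q\<in>T - U. evict_cost I q))"
    by (rule mult_left_mono) simp
  ultimately have "credit_potential I (insert p S0) w1 U
      \<le> credit_potential I S0 w0 T + real (width I) * (\<Sum>q\<in>T - U. evict_cost I q)"
    by (simp add: credit_potential_def algebra_simps)
  with IH evict cost have "alg_cost credit_alg I (ps @ [p]) + credit_potential I S w U
      \<le> real (width I) * (schedule_cost I {} Us + (\<Sum>q\<in>T - U. evict_cost I q))"
    by (simp add: algebra_simps)
  then show ?case
    unfolding U(1) schedule_cost_snoc T_def by simp
qed

lemma online_algorithm_credit_alg: "online_algorithm credit_alg"
  unfolding online_algorithm_def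
  using credit_state_invariant by (metis surj_pair)

lemma credit_alg_competitive:
  assumes I: "paging_instance I"
  shows "competitive_on credit_alg I (real (width I))"
  unfolding competitive_on_def
proof (intro allI impI)
  fix ps assume ps: "set ps \<subseteq> pages I"
  obtain Ts where Ts: "schedule I {} ps Ts" "schedule_cost I {} Ts = opt I ps"
    using opt_attained(1)[OF I ps] by blast
  obtain S w where s: "credit_state I ps = (S, w)" by fastforce
  have "valid_credit I S w"
    using credit_state_invariant[OF I ps s] by blast
  \<comment> \<open>The final potential may be dropped, as credits lie between 0 and the eviction
    cost.\<close>
  then have "0 \<le> credit_potential I S w T" for T
    unfolding credit_potential_def valid_credit_def
    by (intro add_nonneg_nonneg mult_nonneg_nonneg sum_nonneg) auto
  from this[of "last ({} # Ts)"] show "alg_cost credit_alg I ps \<le> real (width I) * opt I ps"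
    using credit_potential_bound[OF I ps s Ts(1)] unfolding Ts(2) by linarith
qed

section \<open>The adversary\<close>

text \<open>Classical paging with cache size \<open>l\<close> and unit costs.\<close>

definition uniform_instance :: "'p set \<Rightarrow> nat \<Rightarrow> 'p paging_instance" where
  "uniform_instance P l =
     \<lparr>pages = P, evict_cost = (\<lambda>_. 1), feas_fun = card, threshold = l\<rparr>"

lemma uniform_instance_simps [simp]:
  "pages (uniform_instance P l) = P"
  "evict_cost (uniform_instance P l) p = 1"
  "feasible (uniform_instance P l) S \<longleftrightarrow> card S \<le> l"
  by (simp_all add: uniform_instance_def feasible_def)

lemma paging_instance_uniform:
  assumes "finite P" "1 \<le> l"
  shows "paging_instance (uniform_instance P l)"
  using assms unfolding paging_instance_def uniform_instance_def
  by (auto intro!: mono_onI card_mono intro: finite_subset)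

text \<open>With \<open>l + 1\<close> pages, the whole of \<open>P\<close> is the only infeasible
  set of pages.\<close>

lemma width_uniform:
  assumes "finite P" "card P = Suc l"
  shows "width (uniform_instance P l) = l"
proof -
  have "minimally_infeasible (uniform_instance P l) S \<longleftrightarrow> S = P" for S
  proof
    assume S: "minimally_infeasible (uniform_instance P l) S"
    then have "S \<subseteq> P" "l < card S"
      by (auto simp: minimally_infeasible_def)
    then show "S = P"
      using assms by (intro card_seteq) auto
  next
    assume "S = P"
    then show "minimally_infeasible (uniform_instance P l) S"
      using assms psubset_card_mono[OF assms(1)] by (auto simp: minimally_infeasible_def less_Suc_eq_le)
  qed
  then show ?thesis
    using assms(2) by (simp add: width_def)
qed

text \<open>The page \<open>r\<close> is the one kept out of the cache, and it is known not to be requested in the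
  next \<open>m\<close> steps.\<close>

lemma uniform_offline_schedule:
  assumes P: "finite P" "card P = Suc l" and l: "1 \<le> l"
    and "set ps \<subseteq> P" "r \<in> P" "S \<subseteq> P - {r}" "m \<le> l" "r \<notin> set (take m ps)"
  shows "\<exists>Ts. schedule (uniform_instance P l) S ps Ts \<and>
    real l * schedule_cost (uniform_instance P l) S Ts \<le> real (length ps) + real l - real m"
  using assms(4-)
proof (induction ps arbitrary: S r m)
  case Nil
  then show ?case by (intro exI[of _ "[]"]) simp
next
  case (Cons p ps)
  let ?I = "uniform_instance P l"
  have card_le: "card T \<le> l" if "T \<subseteq> P - {q}" "q \<in> P" for T q
    using card_mono[OF _ that(1)] that(2) P by simp
  show ?case
  proof (cases "p = r")
    case False
    have sub: "insert p S \<subseteq> P - {r}" and "r \<notin> set (take (m - 1) ps)" and "m - 1 \<le> l"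
      using Cons.prems False by (cases m; auto)+
    then obtain Ts where Ts: "schedule ?I (insert p S) ps Ts"
      "real l * schedule_cost ?I (insert p S) Ts \<le> real (length ps) + real l - real (m - 1)"
      using Cons.IH[of r "insert p S" "m - 1"] Cons.prems(1,2) by (meson set_subset_Cons subset_trans)
    have "S - insert p S = {}" by blast
    then have "schedule_cost ?I S (insert p S # Ts) = schedule_cost ?I (insert p S) Ts"
      unfolding schedule_cost.simps by (simp only: sum.empty add_0)
    moreover have "real m \<le> real (m - 1) + 1" by linarith
    ultimately have "real l * schedule_cost ?I S (insert p S # Ts)
        \<le> real (length (p # ps)) + real l - real m"
      using Ts(2) by (simp del: schedule_cost.simps)
    moreover have "schedule ?I S (p # ps) (insert p S # Ts)"
      using Ts(1) card_le[OF sub Cons.prems(2)] by simp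
    ultimately show ?thesis by blast
  next
    case True
    then have m: "m = 0"
      using Cons.prems(5) by (cases m) auto
    \<comment> \<open>The next \<open>l\<close> requests leave some page \<open>q\<close> of the
      \<open>l + 1\<close> untouched. As \<open>p\<close> is the first of them, the promise for
      \<open>q\<close> after this step is \<open>l - 1\<close>.\<close>
    have "card (set (take l (p # ps))) \<le> l"
      using card_length[of "take l (p # ps)"] by simp
    then have "\<not> P \<subseteq> set (take l (p # ps))"
      using P(2) card_mono[of "set (take l (p # ps))" P] by auto
    then obtain q where q: "q \<in> P" "q \<notin> set (take l (p # ps))" by blast
    then have q': "q \<noteq> p" "q \<notin> set (take (l - 1) ps)"
      using l by (cases l; auto)+
    define T where "T = insert p S - {q}"
    have sub: "T \<subseteq> P - {q}"
      using Cons.prems by (auto simp: T_def)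
    then obtain Ts where Ts: "schedule ?I T ps Ts"
      "real l * schedule_cost ?I T Ts \<le> real (length ps) + real l - real (l - 1)"
      using Cons.IH[of q T "l - 1"] Cons.prems(1) q(1) q'(2)
      by (meson diff_le_self set_subset_Cons subset_trans)
    \<comment> \<open>The eviction contributes at most \<open>l\<close> to the scaled cost: raising
      the promise from 0 to \<open>l - 1\<close> covers \<open>l - 1\<close>, and the request itself
      covers 1.\<close>
    have "card (S - T) \<le> card {q}"
      by (rule card_mono) (auto simp: T_def)
    then have "real l * real (card (S - T)) \<le> real l * 1"
      by (intro mult_left_mono) simp_all
    moreover have "real l * schedule_cost ?I S (T # Ts)
        = real l * real (card (S - T)) + real l * schedule_cost ?I T Ts"
      by (simp add: distrib_left)
    moreover have "real (l - 1) = real l - 1"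
      using l by (simp add: of_nat_diff)
    ultimately have "real l * schedule_cost ?I S (T # Ts)
        \<le> real (length (p # ps)) + real l - real m"
      using Ts(2) m by (simp only: list.size of_nat_Suc of_nat_add of_nat_0)
    moreover have "schedule ?I S (p # ps) (T # Ts)"
      using Ts(1) card_le[OF sub q(1)] q'(1) by (auto simp: T_def)
    ultimately show ?thesis by blast
  qed
qed

lemma opt_uniform_le:
  assumes "finite P" "card P = Suc l" "1 \<le> l" "set ps \<subseteq> P"
  shows "real l * opt (uniform_instance P l) ps \<le> real (length ps) + real l"
proof -
  \<comment> \<open>With an empty cache any page can play \<open>r\<close>, and \<open>m = 0\<close>
    promises nothing about it.\<close>
  obtain r where "r \<in> P"
    using assms(2) by fastforce
  then obtain Ts where Ts: "schedule (uniform_instance P l) {} ps Ts"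
    "real l * schedule_cost (uniform_instance P l) {} Ts \<le> real (length ps) + real l"
    using uniform_offline_schedule[OF assms, of r "{}" 0] by auto
  have "opt (uniform_instance P l) ps \<le> schedule_cost (uniform_instance P l) {} Ts"
    using opt_attained(2)[OF paging_instance_uniform[OF assms(1,3)] _ Ts(1)] assms(4) by simp
  then have "real l * opt (uniform_instance P l) ps
      \<le> real l * schedule_cost (uniform_instance P l) {} Ts"
    by (rule mult_left_mono) simp
  with Ts(2) show ?thesis by linarith
qed

section \<open>Request sequences that fault at every step\<close>

text \<open>Always requesting a missing page gives \<open>n\<close> fetches; those not undone by a
  unit-cost eviction make up the final cache.\<close>

lemma uniform_adversary:
  assumes P: "finite P" "card P = Suc l" and l: "1 \<le> l" and A: "online_algorithm A"
  shows "\<exists>ps. set ps \<subseteq> P \<and> length ps = n \<and>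
    alg_cost A (uniform_instance P l) ps
      = real n - real (card (last ({} # alg_run A (uniform_instance P l) ps)))"
proof (induction n)
  case 0
  show ?case by (simp add: alg_cost_def)
next
  case (Suc n)
  let ?I = "uniform_instance P l"
  have sched: "schedule ?I {} qs (alg_run A ?I qs)" if "set qs \<subseteq> P" for qs
    using A paging_instance_uniform[OF P(1) l] that by (simp add: online_algorithm_def)
  obtain ps where ps: "set ps \<subseteq> P" "length ps = n"
    "alg_cost A ?I ps = real n - real (card (last ({} # alg_run A ?I ps)))"
    using Suc.IH by blast
  define C where "C = last ({} # alg_run A ?I ps)"
  have C: "C \<subseteq> P" "card C \<le> l"
  proof -
    show "C \<subseteq> P"
      using schedule_last_subset[OF sched[OF ps(1)]] ps(1) by (auto simp: C_def simp del: last.simps)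
    show "card C \<le> l"
      using sched[OF ps(1)]
      by (cases ps rule: rev_cases) (auto simp: C_def alg_run_snoc schedule_snoc)
  qed
  then obtain p where p: "p \<in> P" "p \<notin> C"
    using P(2) by (metis Suc_n_not_le_n subsetI subset_antisym)
  define D where "D = A ?I (ps @ [p])"
  have D: "p \<in> D" "D \<subseteq> insert p C"
    using sched[of "ps @ [p]"] ps(1) p(1)
    by (auto simp: alg_run_snoc schedule_snoc D_def C_def simp del: last.simps)
  have fin: "finite C" "finite D"
    using C(1) D(2) P(1) by (meson finite_insert finite_subset)+
  have "card (insert p C) = card (C - D) + card D"
  proof -
    have "insert p C = (C - D) \<union> D" using D by blast
    moreover have "card ((C - D) \<union> D) = card (C - D) + card D"
      using fin by (intro card_Un_disjoint) auto
    ultimately show ?thesis by simp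
  qed
  then have "real (card (C - D)) = real (Suc (card C)) - real (card D)"
    using p fin by simp
  moreover have "alg_cost A ?I (ps @ [p]) = alg_cost A ?I ps + real (card (C - D))"
    unfolding alg_cost_def alg_run_snoc schedule_cost_snoc by (simp add: C_def D_def)
  ultimately have "alg_cost A ?I (ps @ [p]) = real (Suc n) - real (card D)"
    using ps(3) by (simp add: C_def)
  then show ?case
    using ps p by (intro exI[of _ "ps @ [p]"]) (simp add: alg_run_snoc D_def)
qed

lemma uniform_not_competitive:
  assumes P: "finite P" "card P = Suc l" and l: "1 \<le> l" and A: "online_algorithm A"
    and \<rho>: "\<rho> < real l"
  shows "\<not> competitive_on A (uniform_instance P l) \<rho>"
proof
  let ?I = "uniform_instance P l"
  assume comp: "competitive_on A ?I \<rho>"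
  \<comment> \<open>A negative \<rho> is replaced by 0, so that upper bounds on the optimum can be
    multiplied by the ratio.\<close>
  define \<sigma> where "\<sigma> = max \<rho> 0"
  have \<sigma>: "0 \<le> \<sigma>" "\<rho> \<le> \<sigma>" "\<sigma> < real l"
    using \<rho> l by (auto simp: \<sigma>_def)
  \<comment> \<open>This \<open>n\<close> violates
    \<open>l * (n - l) \<le> \<sigma> * (n + l)\<close>, to which the competitive bound leads: the
    additive terms lose against the gap between \<open>l\<close> and \<sigma>.\<close>
  obtain n :: nat where n: "real l * (real l + \<sigma>) < real n * (real l - \<sigma>)"
    using reals_Archimedean3[of "real l - \<sigma>"] \<sigma>(3) by auto
  obtain ps where ps: "set ps \<subseteq> P" "length ps = n"
    "alg_cost A ?I ps = real n - real (card (last ({} # alg_run A ?I ps)))"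
    using uniform_adversary[OF P l A] by blast
  have I: "paging_instance ?I"
    by (rule paging_instance_uniform[OF P(1) l])
  have "schedule ?I {} ps (alg_run A ?I ps)"
    using A I ps(1) by (simp add: online_algorithm_def)
  then have "card (last ({} # alg_run A ?I ps)) \<le> l"
    by (cases ps rule: rev_cases) (auto simp: alg_run_snoc schedule_snoc)
  then have "real n - real l \<le> alg_cost A ?I ps"
    unfolding ps(3) by simp
  also have "\<dots> \<le> \<rho> * opt ?I ps"
    using comp ps(1) by (simp add: competitive_on_def)
  also have "\<dots> \<le> \<sigma> * opt ?I ps"
  proof -
    have "0 \<le> opt ?I ps"
      using opt_attained(1)[OF I] schedule_cost_nonneg[OF I] ps(1)
      by (metis empty_subsetI uniform_instance_simps(1))
    with \<sigma>(2) show ?thesis by (rule mult_right_mono)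
  qed
  finally have "real l * (real n - real l) \<le> \<sigma> * (real l * opt ?I ps)"
    using mult_left_mono[of "real n - real l" "\<sigma> * opt ?I ps" "real l"] by (simp add: mult_ac)
  also have "\<dots> \<le> \<sigma> * (real n + real l)"
    using opt_uniform_le[OF P l ps(1)] ps(2) \<sigma>(1) by (simp add: mult_left_mono)
  finally show False
    using n by (simp add: algebra_simps)
qed

theorem theorem1p2:
  "(\<exists>A :: 'p online_alg. online_algorithm A \<and>
      (\<forall>I. paging_instance I \<longrightarrow> competitive_on A I (real (width I))))
   \<and>
   (infinite (UNIV :: 'p set) \<longrightarrow>
      (\<forall>l::nat. l \<ge> 1 \<longrightarrow>
        (\<forall>A :: 'p online_alg. online_algorithm A \<longrightarrow>
          (\<forall>\<rho>::real. \<rho> < real l \<longrightarrow>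
            \<not> (\<forall>I. paging_instance I \<and> width I = l \<longrightarrow> competitive_on A I \<rho>)))))"
proof (intro conjI impI allI notI)
  show "\<exists>A :: 'p online_alg. online_algorithm A \<and>
      (\<forall>I. paging_instance I \<longrightarrow> competitive_on A I (real (width I)))"
    using online_algorithm_credit_alg credit_alg_competitive by blast
next
  fix l :: nat and A :: "'p online_alg" and \<rho> :: real
  assume inf: "infinite (UNIV :: 'p set)" and l: "1 \<le> l" and A: "online_algorithm A"
    and \<rho>: "\<rho> < real l"
    and comp: "\<forall>I. paging_instance I \<and> width I = l \<longrightarrow> competitive_on A I \<rho>"
  \<comment> \<open>The infinite page type supplies \<open>l + 1\<close> pages for every
    \<open>l\<close>.\<close>
  obtain P :: "'p set" where P: "finite P" "card P = Suc l"
    using infinite_arbitrarily_large[OF inf] by blast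
  have "competitive_on A (uniform_instance P l) \<rho>"
    using comp paging_instance_uniform[OF P(1) l] width_uniform[OF P] by blast
  with uniform_not_competitive[OF P l A \<rho>] show False by blast
qed

end
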